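(* Let $f$ be analytic on the upper half plane and polynomially bounded in every vertical strip $\{\sigma_1\le\sigma\le\sigma_2,\ t\ge1\}$. Suppose that, for some $d\ge1$, its order function $\mu$ satisfies $$\mu(\sigma)=\mu(1-\sigma)+d\left(\tfrac12-\sigma\right)\quad(\sigma\in\mathbb{R}),\qquad \mu(\sigma)=0\quad(\sigma\ge1),$$ that the family $\sigma_p(\alpha)$ of $L^p$ abscissae of $f$ is approximately concave, and that $\mu'(1/2)$ exists. Then $\mu$ is differentiable everywhere on $\mathbb{R}$, $\mu(1/2)<d/4$, $$\mu(\sigma)\le\frac{d}{2+4\sigma}=d\left(\tfrac12-\sigma\right)+\frac{2d\sigma^2}{1+2\sigma}\qquad(0\le\sigma<b),$$ and $$\mu(\sigma)\le 2d(1-\sigma)^2\qquad(1-b<\sigma\le1).$$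
   Context: Write $s=\sigma+it$. "Polynomially bounded" in a strip means $|f(\sigma+it)|\le C t^{A}$ there for some constants $A,C$ (depending on the strip). Order function: $\mu(\sigma)=\inf\{\mu\ge 0: f(\sigma+it)\ll t^{\mu}\ (t\ge1)\}$, $\sigma\in\mathbb{R}$. By the Phragmén–Lindelöf theorem $\mu$ is convex, and here it is non-increasing. Let $b\le 1$ be the number with $\mu(\sigma)>0$ for $\sigma<b$ and $\mu(\sigma)=0$ for $\sigma\ge b$. $L^p$ abscissae: given a real $a<1$ with $\mu(a)>0$, for real $p>0$ and $1<\alpha\le\mu(a)p$, $$\sigma_p(\alpha)=\inf\Big\{\sigma\in[a,1]: \Big(\int_1^\infty |f(\sigma+it)|^p\,\frac{dt}{t^\alpha}\Big)^{1/p}<\infty\Big\}.$$ Approximate concavity on the strip $a\le\sigma\le1$: for every $\varepsilon>0$ there is $P$ such that for all $q,r>0$, $\phi\in[0,1]$ with $p=\phi q+(1-\phi)r\ge P$, and all $\alpha$ with $1<\alpha\le\mu(a)\min(q,r)$, one has $\phi\,\sigma_q(\alpha)+(1-\phi)\,\sigma_r(\alpha)\le\sigma_p(\alpha)+\varepsilon$. For $f$ on the upper half plane, "approximately concave" means that this holds for every real $a<1$ with $\mu(a)>0$. *)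

theory Defs
  imports "HOL-Complex_Analysis.Complex_Analysis"
begin

definition polynomially_bounded_in_strips :: "(complex \<Rightarrow> complex) \<Rightarrow> bool" where
  "polynomially_bounded_in_strips f \<longleftrightarrow>
     (\<forall>\<sigma>\<^sub>1 \<sigma>\<^sub>2. \<exists>C A. \<forall>\<sigma>\<in>{\<sigma>\<^sub>1..\<sigma>\<^sub>2}. \<forall>t\<ge>1. norm (f (Complex \<sigma> t)) \<le> C * t powr A)"

(* The infimum is over a set that is bounded below by 0; it is nonempty for every \<sigma> as soon as
   f is polynomially bounded in strips. *)
definition order_function :: "(complex \<Rightarrow> complex) \<Rightarrow> real \<Rightarrow> real" where
  "order_function f \<sigma> =
     Inf {m. m \<ge> 0 \<and> (\<exists>C. \<forall>t\<ge>1. norm (f (Complex \<sigma> t)) \<le> C * t powr m)}"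

definition order_threshold :: "(complex \<Rightarrow> complex) \<Rightarrow> real" where
  "order_threshold f =
     (THE b. b \<le> 1 \<and> (\<forall>\<sigma><b. order_function f \<sigma> > 0) \<and> (\<forall>\<sigma>\<ge>b. order_function f \<sigma> = 0))"

(* Only finiteness of the L^p norm matters, so the outer exponent 1/p (p > 0) is dropped.
   The definition is meant for a < 1, p > 0 and 1 < \<alpha> \<le> order_function f a * p; the set is then
   nonempty if order_function f 1 = 0, because it contains 1. *)
definition Lp_abscissa :: "(complex \<Rightarrow> complex) \<Rightarrow> real \<Rightarrow> real \<Rightarrow> real \<Rightarrow> real" where
  "Lp_abscissa f a p \<alpha> =
     Inf {\<sigma> \<in> {a..1}.
            (\<integral>\<^sup>+ t\<in>{1..}. ennreal (norm (f (Complex \<sigma> t)) powr p / t powr \<alpha>) \<partial>lborel) < \<infinity>}"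

definition approx_concave_on_strip :: "(complex \<Rightarrow> complex) \<Rightarrow> real \<Rightarrow> bool" where
  "approx_concave_on_strip f a \<longleftrightarrow>
     (\<forall>\<epsilon>>0. \<exists>P. \<forall>q>0. \<forall>r>0. \<forall>\<phi>\<in>{0..1}. \<forall>\<alpha>.
        \<phi> * q + (1 - \<phi>) * r \<ge> P \<longrightarrow> 1 < \<alpha> \<longrightarrow> \<alpha> \<le> order_function f a * min q r \<longrightarrow>
        \<phi> * Lp_abscissa f a q \<alpha> + (1 - \<phi>) * Lp_abscissa f a r \<alpha>
          \<le> Lp_abscissa f a (\<phi> * q + (1 - \<phi>) * r) \<alpha> + \<epsilon>)"

definition approx_concave :: "(complex \<Rightarrow> complex) \<Rightarrow> bool" where
  "approx_concave f \<longleftrightarrow> (\<forall>a<1. order_function f a > 0 \<longrightarrow> approx_concave_on_strip f a)"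

end

(* Idea. Since the abscissae sigma_p(l) with p = l / mu(sigma) tend to sigma as l grows, approximate
   concavity forces 1/mu to be convex on sigma < b, while mu itself is convex. So at each sigma < b
   the function mu lies between a supporting line of mu and the reciprocal of a supporting line of
   1/mu, hence is differentiable there; the functional equation covers sigma >= b once b > 1/2, which
   holds because mu'(1/2) = -d/2 is not 0. The tangent of 1/mu at 0, where mu = d/2 and mu' = -d,
   gives the upper bounds, and strictness at 1/2 follows by comparing derivatives at 1/2. *)
theory Submission
  imports Defs
begin

section \<open>A three lines bound\<close>

text \<open>The abscissae see \<open>f\<close> only through integrals along vertical lines, whereas
  \<mu> is pointwise. The bridge is a three lines bound whose edges enter through local Gaussian
  means: it gives the convexity of \<mu>, and it also turns an L^p bound on one line into a
  pointwise bound further right. The passage costs only bounded amounts (rounding p down to an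
  integer, the 1 in \<alpha> - 1), which become negligible when \<alpha> and p grow in proportion;
  so an error \<epsilon> uniform in \<alpha> still yields exact convexity of 1/\<mu>. The two
  convexities and the functional equation also hold for max(0, d(1/2 - \<sigma>)), where b = 1/2 and
  \<mu> has a corner. The derivative at 1/2 is what excludes this case. Once b > 1/2, a corner at b
  would be mirrored to 1 - b < b, where convexity of 1/\<mu> forbids it.\<close>

lemma norm_contour_integral_vertical_le:
  assumes "a < b" and cont: "continuous_on {a..b} (\<lambda>t. g (Complex c t))"
  shows "norm (contour_integral (linepath (Complex c a) (Complex c b)) g)
           \<le> integral {a..b} (\<lambda>t. norm (g (Complex c t)))"
proof -
  let ?J = "integral {a..b} (\<lambda>t. g (Complex c t))"
  have "((\<lambda>t. g (Complex c t)) has_integral ?J) {a..b}"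
    using cont by (intro integrable_integral integrable_continuous_real)
  then have "(g has_contour_integral \<i> * ?J) (linepath (Complex c a) (Complex c b))"
    using assms(1) by (subst has_contour_integral_linepath_same_Re_iff) auto
  then have "contour_integral (linepath (Complex c a) (Complex c b)) g = \<i> * ?J"
    by (rule contour_integral_unique)
  moreover have "norm ?J \<le> integral {a..b} (\<lambda>t. norm (g (Complex c t)))"
    using cont by (intro integral_norm_bound_integral integrable_continuous_real continuous_intros) auto
  ultimately show ?thesis by (simp add: norm_mult)
qed

lemma continuous_on_vertical:
  assumes "f holomorphic_on {s. Im s > 0}" "S \<subseteq> {0<..}"
  shows "continuous_on S (\<lambda>t. f (Complex c t))"
proof -
  have "continuous_on {s. Im s > 0} f"
    using assms(1) by (rule holomorphic_on_imp_continuous_on)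
  moreover have "continuous_on S (\<lambda>t. Complex c t)"
    by (intro continuous_intros)
  ultimately show ?thesis
    by (rule continuous_on_compose2) (use assms(2) in auto)
qed

text \<open>Cauchy's integral formula, with the kernel bounded on each edge by the inverse distance
  of that edge from the centre. The vertical edges keep integrals instead of suprema, so that an L^p
  hypothesis can be fed into them.\<close>

lemma norm_le_rectangle_edges:
  assumes H: "H holomorphic_on {s. Im s > 0}" and y: "0 < y\<^sub>0" "y\<^sub>0 < T" "T < y\<^sub>1"
    and x: "\<sigma>\<^sub>1 < \<sigma>" "\<sigma> < \<sigma>\<^sub>2"
    and B0: "\<And>x. x \<in> {\<sigma>\<^sub>1..\<sigma>\<^sub>2} \<Longrightarrow> norm (H (Complex x y\<^sub>0)) \<le> B\<^sub>0"
    and B1: "\<And>x. x \<in> {\<sigma>\<^sub>1..\<sigma>\<^sub>2} \<Longrightarrow> norm (H (Complex x y\<^sub>1)) \<le> B\<^sub>1"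
  shows "2 * pi * norm (H (Complex \<sigma> T)) \<le>
      integral {y\<^sub>0..y\<^sub>1} (\<lambda>t. norm (H (Complex \<sigma>\<^sub>1 t))) / (\<sigma> - \<sigma>\<^sub>1)
    + integral {y\<^sub>0..y\<^sub>1} (\<lambda>t. norm (H (Complex \<sigma>\<^sub>2 t))) / (\<sigma>\<^sub>2 - \<sigma>)
    + (\<sigma>\<^sub>2 - \<sigma>\<^sub>1) * (B\<^sub>0 / (T - y\<^sub>0) + B\<^sub>1 / (y\<^sub>1 - T))"
proof -
  define U where "U = {s. Im s > 0}"
  define s where "s = Complex \<sigma> T"
  define g where "g = (\<lambda>w. H w / (w - s))"
  let ?a = "Complex \<sigma>\<^sub>1 y\<^sub>0" let ?b = "Complex \<sigma>\<^sub>2 y\<^sub>0"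
  let ?c = "Complex \<sigma>\<^sub>2 y\<^sub>1" let ?d = "Complex \<sigma>\<^sub>1 y\<^sub>1"
  let ?\<gamma> = "rectpath ?a ?c"
  have sbox: "s \<in> box ?a ?c"
    using x y by (auto simp: s_def in_box_complex_iff)
  have pU: "path_image ?\<gamma> \<subseteq> U"
  proof -
    have "path_image ?\<gamma> \<subseteq> cbox ?a ?c"
      by (rule path_image_rectpath_subset_cbox) (use x y in auto)
    also have "\<dots> \<subseteq> U" using y by (auto simp: U_def in_cbox_complex_iff)
    finally show ?thesis .
  qed
  have ps: "s \<notin> path_image ?\<gamma>"
    using sbox x y by (subst path_image_rectpath_cbox_minus_box) auto
  have "(g has_contour_integral (2 * pi * \<i> * winding_number ?\<gamma> s * H s)) ?\<gamma>"
    unfolding g_def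
  proof (rule Cauchy_integral_formula_convex_simple)
    show "convex U" unfolding U_def by (rule convex_halfspace_Im_gt)
    show "H holomorphic_on U" using H by (simp add: U_def)
    have "open U" unfolding U_def by (rule open_halfspace_Im_gt)
    then show "s \<in> interior U" using y by (simp add: interior_open, simp add: U_def s_def)
  qed (use pU ps in auto)
  moreover have "winding_number ?\<gamma> s = 1"
    using sbox by (rule winding_number_rectpath)
  ultimately have I: "(g has_contour_integral (2 * pi * \<i> * H s)) ?\<gamma>" by simp
  have contg: "continuous_on (U - {s}) g"
    unfolding g_def
  proof (intro continuous_on_divide)
    show "continuous_on (U - {s}) H"
      by (rule continuous_on_subset[OF holomorphic_on_imp_continuous_on[OF H]]) (auto simp: U_def)
    show "continuous_on (U - {s}) (\<lambda>w. w - s)" by (intro continuous_intros)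
  qed auto
  have seg: "closed_segment ?a ?b \<subseteq> U - {s}" "closed_segment ?b ?c \<subseteq> U - {s}"
     "closed_segment ?c ?d \<subseteq> U - {s}" "closed_segment ?d ?a \<subseteq> U - {s}"
    using x y by (auto simp: closed_segment_same_Re closed_segment_same_Im U_def s_def closed_segment_eq_real_ivl)
  have gi: "g contour_integrable_on (linepath u v)" if "closed_segment u v \<subseteq> U - {s}" for u v
    by (rule contour_integrable_continuous_linepath[OF continuous_on_subset[OF contg that]])
  have "2 * pi * \<i> * H s = contour_integral ?\<gamma> g"
    using I by (simp add: contour_integral_unique)
  also have "\<dots> = contour_integral (linepath ?a ?b) g + contour_integral (linepath ?b ?c) g
      + contour_integral (linepath ?c ?d) g + contour_integral (linepath ?d ?a) g"
    unfolding rectpath_def Let_def using gi seg by (simp add: contour_integrable_joinI)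
  \<comment> \<open>The left edge is reoriented so that \<open>vert\<close> covers both vertical
    edges.\<close>
  also have "contour_integral (linepath ?d ?a) g = - contour_integral (linepath ?a ?d) g"
    using continuous_on_subset[OF contg seg(4)] by (rule contour_integral_reverse_linepath)
  finally have eq: "2 * pi * \<i> * H s = contour_integral (linepath ?a ?b) g + contour_integral (linepath ?b ?c) g
      + contour_integral (linepath ?c ?d) g - contour_integral (linepath ?a ?d) g" by simp
  have n1: "norm (contour_integral (linepath ?a ?b) g) \<le> B\<^sub>0 / (T - y\<^sub>0) * (\<sigma>\<^sub>2 - \<sigma>\<^sub>1)"
  proof -
    have B: "0 \<le> B\<^sub>0" using order_trans[OF norm_ge_zero B0[of \<sigma>]] x by simp
    have "norm (contour_integral (linepath ?a ?b) g) \<le> B\<^sub>0 / (T - y\<^sub>0) * norm (?b - ?a)"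
    proof (rule contour_integral_bound_linepath[OF gi[OF seg(1)]])
      show "0 \<le> B\<^sub>0 / (T - y\<^sub>0)" using B y by simp
      fix z assume "z \<in> closed_segment ?a ?b"
      then obtain u where u: "z = Complex u y\<^sub>0" "u \<in> {\<sigma>\<^sub>1..\<sigma>\<^sub>2}"
        using x by (cases z) (auto simp: closed_segment_same_Im closed_segment_eq_real_ivl)
      have "T - y\<^sub>0 \<le> \<bar>Im (z - s)\<bar>" using y by (simp add: u s_def)
      also have "\<dots> \<le> norm (z - s)" by (rule abs_Im_le_cmod)
      finally show "norm (g z) \<le> B\<^sub>0 / (T - y\<^sub>0)"
        unfolding g_def norm_divide using B0[OF u(2)] y B by (intro frac_le) (auto simp: u)
    qed
    also have "norm (?b - ?a) = \<sigma>\<^sub>2 - \<sigma>\<^sub>1" using x by (simp add: cmod_def)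
    finally show ?thesis .
  qed
  have n3: "norm (contour_integral (linepath ?c ?d) g) \<le> B\<^sub>1 / (y\<^sub>1 - T) * (\<sigma>\<^sub>2 - \<sigma>\<^sub>1)"
  proof -
    have B: "0 \<le> B\<^sub>1" using order_trans[OF norm_ge_zero B1[of \<sigma>]] x by simp
    have "norm (contour_integral (linepath ?c ?d) g) \<le> B\<^sub>1 / (y\<^sub>1 - T) * norm (?d - ?c)"
    proof (rule contour_integral_bound_linepath[OF gi[OF seg(3)]])
      show "0 \<le> B\<^sub>1 / (y\<^sub>1 - T)" using B y by simp
      fix z assume "z \<in> closed_segment ?c ?d"
      then obtain u where u: "z = Complex u y\<^sub>1" "u \<in> {\<sigma>\<^sub>1..\<sigma>\<^sub>2}"
        using x by (cases z) (auto simp: closed_segment_same_Im closed_segment_eq_real_ivl)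
      have "y\<^sub>1 - T \<le> \<bar>Im (z - s)\<bar>" using y by (simp add: u s_def)
      also have "\<dots> \<le> norm (z - s)" by (rule abs_Im_le_cmod)
      finally show "norm (g z) \<le> B\<^sub>1 / (y\<^sub>1 - T)"
        unfolding g_def norm_divide using B1[OF u(2)] y B by (intro frac_le) (auto simp: u)
    qed
    also have "norm (?d - ?c) = \<sigma>\<^sub>2 - \<sigma>\<^sub>1" using x by (simp add: cmod_def)
    finally show ?thesis .
  qed
  have vert: "norm (contour_integral (linepath (Complex u y\<^sub>0) (Complex u y\<^sub>1)) g)
      \<le> integral {y\<^sub>0..y\<^sub>1} (\<lambda>t. norm (H (Complex u t))) / \<bar>u - \<sigma>\<bar>" if "u \<noteq> \<sigma>" for u
  proof -
    have c: "continuous_on {y\<^sub>0..y\<^sub>1} (\<lambda>t. H (Complex u t))"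
      using H y by (intro continuous_on_vertical) auto
    have cg: "continuous_on {y\<^sub>0..y\<^sub>1} (\<lambda>t. g (Complex u t))"
      unfolding g_def using that c by (intro continuous_intros) (auto simp: s_def complex_eq_iff)
    have "norm (contour_integral (linepath (Complex u y\<^sub>0) (Complex u y\<^sub>1)) g)
        \<le> integral {y\<^sub>0..y\<^sub>1} (\<lambda>t. norm (g (Complex u t)))"
      using y cg by (intro norm_contour_integral_vertical_le) auto
    also have "\<dots> \<le> integral {y\<^sub>0..y\<^sub>1} (\<lambda>t. norm (H (Complex u t)) / \<bar>u - \<sigma>\<bar>)"
    proof (rule integral_le)
      fix t
      have "\<bar>u - \<sigma>\<bar> \<le> norm (Complex u t - s)"
        using abs_Re_le_cmod[of "Complex u t - s"] by (simp add: s_def)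
      then show "norm (g (Complex u t)) \<le> norm (H (Complex u t)) / \<bar>u - \<sigma>\<bar>"
        unfolding g_def norm_divide using that by (intro divide_left_mono) (auto simp: s_def complex_eq_iff)
    qed (use c cg that in \<open>auto intro!: integrable_continuous_real continuous_intros\<close>)
    finally show ?thesis by simp
  qed
  have "2 * pi * norm (H s) = norm (2 * pi * \<i> * H s)" by (simp add: norm_mult)
  also have "\<dots> \<le> norm (contour_integral (linepath ?a ?b) g) + norm (contour_integral (linepath ?b ?c) g)
      + norm (contour_integral (linepath ?c ?d) g) + norm (contour_integral (linepath ?a ?d) g)"
    unfolding eq by (smt (verit) norm_triangle_ineq norm_triangle_ineq4)
  also have "\<dots> \<le> B\<^sub>0 / (T - y\<^sub>0) * (\<sigma>\<^sub>2 - \<sigma>\<^sub>1)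
      + integral {y\<^sub>0..y\<^sub>1} (\<lambda>t. norm (H (Complex \<sigma>\<^sub>2 t))) / (\<sigma>\<^sub>2 - \<sigma>)
      + B\<^sub>1 / (y\<^sub>1 - T) * (\<sigma>\<^sub>2 - \<sigma>\<^sub>1)
      + integral {y\<^sub>0..y\<^sub>1} (\<lambda>t. norm (H (Complex \<sigma>\<^sub>1 t))) / (\<sigma> - \<sigma>\<^sub>1)"
    using n1 n3 vert[of \<sigma>\<^sub>1] vert[of \<sigma>\<^sub>2] x by (intro add_mono) auto
  finally show ?thesis by (simp add: s_def algebra_simps)
qed

text \<open>The term T^2 / 4 is what the Gaussian factor gains on horizontal edges at distance T / 2
  from the centre.\<close>

lemma powr_le_exp_square:
  fixes r T :: real
  assumes "0 \<le> r" "1 \<le> T"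
  shows "T powr r \<le> exp (r\<^sup>2) * exp (T\<^sup>2 / 4)"
proof -
  have "r * ln T \<le> r * T"
    using assms ln_le_minus_one[of T] by (intro mult_left_mono) auto
  also have "r * T \<le> r\<^sup>2 + T\<^sup>2 / 4"
    using zero_le_power2[of "r - T / 2"] by (simp add: power2_eq_square algebra_simps)
  finally show ?thesis
    using assms by (simp add: powr_def flip: exp_add)
qed

text \<open>A Phragmen-Lindelof argument with a separate auxiliary function for each height T. The
  parameter \<open>k\<close> is a slope: it tilts the edge exponents so that both are brought below
  \<open>m\<close>.\<close>

lemma three_lines_integral:
  assumes F: "F holomorphic_on {s. Im s > 0}" and \<sigma>: "\<sigma>\<^sub>1 < \<sigma>" "\<sigma> < \<sigma>\<^sub>2"
    and poly: "\<And>x t. x \<in> {\<sigma>\<^sub>1..\<sigma>\<^sub>2} \<Longrightarrow> t \<ge> 1 \<Longrightarrow> norm (F (Complex x t)) \<le> C\<^sub>0 * t powr A\<^sub>0"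
    and I1: "\<And>T. T \<ge> 2 \<Longrightarrow>
      integral {T/2..3*T/2} (\<lambda>t. norm (F (Complex \<sigma>\<^sub>1 t)) * exp (- (t - T)\<^sup>2)) \<le> C\<^sub>1 * T powr A\<^sub>1"
    and I2: "\<And>T. T \<ge> 2 \<Longrightarrow>
      integral {T/2..3*T/2} (\<lambda>t. norm (F (Complex \<sigma>\<^sub>2 t)) * exp (- (t - T)\<^sup>2)) \<le> C\<^sub>2 * T powr A\<^sub>2"
    and k: "A\<^sub>1 + k * (\<sigma>\<^sub>1 - \<sigma>) \<le> m" "A\<^sub>2 + k * (\<sigma>\<^sub>2 - \<sigma>) \<le> m" and m: "0 \<le> m"
  shows "\<exists>C. \<forall>t\<ge>1. norm (F (Complex \<sigma> t)) \<le> C * t powr m"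
proof -
  define D where "D = \<sigma>\<^sub>2 - \<sigma>\<^sub>1"
  define E where "E = exp (D\<^sup>2)"
  define A where "A = \<bar>A\<^sub>0\<bar>"
  define r where "r = A + \<bar>k\<bar> * D"
  define K where "K = \<bar>C\<^sub>0\<bar> * 2 powr A * E * exp (r\<^sup>2)"
  define M where "M = E * \<bar>C\<^sub>1\<bar> / (\<sigma> - \<sigma>\<^sub>1) + E * \<bar>C\<^sub>2\<bar> / (\<sigma>\<^sub>2 - \<sigma>) + D * (K + K)"
  have D: "D > 0" using \<sigma> by (simp add: D_def)
  have A: "A \<ge> 0" and r: "r \<ge> 0" using D by (auto simp: A_def r_def)
  have K: "K \<ge> 0" by (simp add: K_def E_def)
  have M: "M \<ge> 0" using D K \<sigma> by (auto simp: M_def E_def intro!: add_nonneg_nonneg divide_nonneg_pos)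
  have poly': "norm (F (Complex x t)) \<le> \<bar>C\<^sub>0\<bar> * t powr A" if "x \<in> {\<sigma>\<^sub>1..\<sigma>\<^sub>2}" "t \<ge> 1" for x t
  proof -
    have "C\<^sub>0 * t powr A\<^sub>0 \<le> \<bar>C\<^sub>0\<bar> * t powr A"
      using that by (intro mult_mono) (auto simp: A_def intro!: powr_mono)
    with poly[OF that] show ?thesis by linarith
  qed
  have Esq: "exp ((x - \<sigma>)\<^sup>2) \<le> E" if "x \<in> {\<sigma>\<^sub>1..\<sigma>\<^sub>2}" for x
  proof -
    have "\<bar>x - \<sigma>\<bar> \<le> \<bar>D\<bar>" using that \<sigma> by (auto simp: D_def)
    then show ?thesis unfolding E_def using abs_le_square_iff by auto
  qed
  have main: "norm (F (Complex \<sigma> T)) \<le> M * T powr m" if T: "T \<ge> 2" for T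
  proof -
    define s where "s = Complex \<sigma> T"
    \<comment> \<open>\<open>H\<close> agrees with \<open>F\<close> at \<open>s\<close>. The square
      in the exponent gives decay exp(-(t - T)^2) that beats polynomial growth on the horizontal
      edges; the linear term has modulus T powr (k(x - \<sigma>)), which does the tilting.\<close>
    define H where "H = (\<lambda>z. F z * exp ((z - s)\<^sup>2 + of_real (k * ln T) * (z - s)))"
    have holH: "H holomorphic_on {s. Im s > 0}"
      unfolding H_def using F by (intro holomorphic_intros)
    have nH: "norm (H (Complex x t)) =
        norm (F (Complex x t)) * exp (- (t - T)\<^sup>2) * (exp ((x - \<sigma>)\<^sup>2) * T powr (k * (x - \<sigma>)))" for x t
      using T by (simp add: H_def s_def norm_mult powr_def mult_ac Re_power2 diff_conv_add_uminus exp_add del: add_uminus_conv_diff minus_add_distrib)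
    have horiz: "norm (H (Complex x t)) \<le> K"
      if x: "x \<in> {\<sigma>\<^sub>1..\<sigma>\<^sub>2}" and t: "1 \<le> t" "t \<le> 2 * T" "\<bar>t - T\<bar> = T / 2" for x t
    proof -
      have "norm (F (Complex x t)) \<le> \<bar>C\<^sub>0\<bar> * t powr A" by (rule poly') (use x t in auto)
      also have "\<dots> \<le> \<bar>C\<^sub>0\<bar> * (2 * T) powr A"
        using t A by (intro mult_left_mono powr_mono2) auto
      finally have 1: "norm (F (Complex x t)) \<le> \<bar>C\<^sub>0\<bar> * (2 * T) powr A" .
      have "(t - T)\<^sup>2 = (T / 2)\<^sup>2" using t(3) by (metis power2_abs)
      then have 2: "exp (- (t - T)\<^sup>2) = exp (- (T\<^sup>2 / 4))" by (simp add: power_divide)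
      have "k * (x - \<sigma>) \<le> \<bar>k\<bar> * \<bar>x - \<sigma>\<bar>" by (metis abs_ge_self abs_mult)
      also have "\<dots> \<le> \<bar>k\<bar> * D" using x \<sigma> by (intro mult_left_mono) (auto simp: D_def)
      finally have 3: "T powr (k * (x - \<sigma>)) \<le> T powr (\<bar>k\<bar> * D)" using T by (intro powr_mono) auto
      have "norm (H (Complex x t)) \<le> (\<bar>C\<^sub>0\<bar> * (2 * T) powr A) * exp (- (T\<^sup>2 / 4)) * (E * T powr (\<bar>k\<bar> * D))"
        unfolding nH 2 using 1 3 Esq[OF x] T by (intro mult_mono) (auto simp: E_def)
      also have "\<dots> = \<bar>C\<^sub>0\<bar> * 2 powr A * E * T powr r * exp (- (T\<^sup>2 / 4))"
        using T by (simp add: powr_mult r_def powr_add)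
      also have "\<dots> \<le> \<bar>C\<^sub>0\<bar> * 2 powr A * E * (exp (r\<^sup>2) * exp (T\<^sup>2 / 4)) * exp (- (T\<^sup>2 / 4))"
        using powr_le_exp_square[OF r, of T] T by (intro mult_mono) (auto simp: E_def)
      also have "\<dots> = K" by (simp add: K_def exp_minus)
      finally show ?thesis .
    qed
    have vert: "integral {T/2..3*T/2} (\<lambda>t. norm (H (Complex x t))) \<le> E * \<bar>c\<bar> * T powr m"
      if x: "x \<in> {\<sigma>\<^sub>1..\<sigma>\<^sub>2}"
        and I: "integral {T/2..3*T/2} (\<lambda>t. norm (F (Complex x t)) * exp (- (t - T)\<^sup>2)) \<le> c * T powr B"
        and B: "B + k * (x - \<sigma>) \<le> m" for x c B
    proof -
      let ?J = "integral {T/2..3*T/2} (\<lambda>t. norm (F (Complex x t)) * exp (- (t - T)\<^sup>2))"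
      have "integral {T/2..3*T/2} (\<lambda>t. norm (H (Complex x t))) = ?J * (exp ((x - \<sigma>)\<^sup>2) * T powr (k * (x - \<sigma>)))"
        unfolding nH by simp
      also have "\<dots> \<le> (\<bar>c\<bar> * T powr B) * (E * T powr (k * (x - \<sigma>)))"
      proof (intro mult_mono)
        show "?J \<le> \<bar>c\<bar> * T powr B"
          using I by (rule order_trans) (auto intro!: mult_right_mono)
      qed (use Esq[OF x] in \<open>auto simp: E_def\<close>)
      also have "\<dots> = E * \<bar>c\<bar> * T powr (B + k * (x - \<sigma>))"
        by (simp add: powr_add)
      also have "\<dots> \<le> E * \<bar>c\<bar> * T powr m"
        using T B by (intro mult_left_mono powr_mono) (auto simp: E_def)
      finally show ?thesis .
    qed
    have 1: "1 \<le> T powr m" using T m by (simp add: ge_one_powr_ge_zero)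
    have "2 * pi * norm (H (Complex \<sigma> T)) \<le>
        integral {T/2..3*T/2} (\<lambda>t. norm (H (Complex \<sigma>\<^sub>1 t))) / (\<sigma> - \<sigma>\<^sub>1)
      + integral {T/2..3*T/2} (\<lambda>t. norm (H (Complex \<sigma>\<^sub>2 t))) / (\<sigma>\<^sub>2 - \<sigma>)
      + (\<sigma>\<^sub>2 - \<sigma>\<^sub>1) * (K / (T - T/2) + K / (3*T/2 - T))"
      using T \<sigma> holH by (intro norm_le_rectangle_edges horiz) auto
    also have "\<dots> \<le> E * \<bar>C\<^sub>1\<bar> * T powr m / (\<sigma> - \<sigma>\<^sub>1) + E * \<bar>C\<^sub>2\<bar> * T powr m / (\<sigma>\<^sub>2 - \<sigma>)
      + D * (K * T powr m + K * T powr m)"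
    proof (intro add_mono)
      show "(\<sigma>\<^sub>2 - \<sigma>\<^sub>1) * (K / (T - T/2) + K / (3*T/2 - T)) \<le> D * (K * T powr m + K * T powr m)"
        unfolding D_def[symmetric]
      proof (intro mult_left_mono add_mono)
        have "K / (T / 2) \<le> K / 1" using T K by (intro divide_left_mono) auto
        also have "K / 1 \<le> K * T powr m" using K 1 by (simp add: mult_le_cancel_left1)
        finally have *: "K / (T / 2) \<le> K * T powr m" .
        show "K / (T - T/2) \<le> K * T powr m" "K / (3*T/2 - T) \<le> K * T powr m"
          using * by (simp_all add: field_simps)
      qed (use D in auto)
    qed (use \<sigma> T k in \<open>auto intro!: divide_right_mono vert[OF _ I1] vert[OF _ I2]\<close>)
    also have "\<dots> = M * T powr m" by (simp add: M_def algebra_simps)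
    finally have "2 * pi * norm (H (Complex \<sigma> T)) \<le> M * T powr m" .
    moreover have "1 * norm (H (Complex \<sigma> T)) \<le> 2 * pi * norm (H (Complex \<sigma> T))"
      using pi_ge_two by (intro mult_right_mono) auto
    moreover have "H (Complex \<sigma> T) = F (Complex \<sigma> T)" by (simp add: H_def s_def)
    ultimately show ?thesis by simp
  qed
  show ?thesis
  proof (intro exI allI impI)
    fix t :: real assume t: "t \<ge> 1"
    have 1: "1 \<le> t powr m" using t m by (simp add: ge_one_powr_ge_zero)
    show "norm (F (Complex \<sigma> t)) \<le> (M + \<bar>C\<^sub>0\<bar> * 2 powr A) * t powr m"
    proof (cases "t \<ge> 2")
      case True
      then show ?thesis using main[OF True] by (simp add: algebra_simps add_increasing2)
    next
      \<comment> \<open>For t < 2 the window around t would drop below height 1, so the strip bound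
        takes over, at the price of a constant.\<close>
      case False
      have "norm (F (Complex \<sigma> t)) \<le> \<bar>C\<^sub>0\<bar> * t powr A" using poly' \<sigma> t by auto
      also have "\<dots> \<le> \<bar>C\<^sub>0\<bar> * 2 powr A" using False t A by (intro mult_left_mono powr_mono2) auto
      also have "\<dots> \<le> \<bar>C\<^sub>0\<bar> * 2 powr A * t powr m" using mult_left_mono[OF 1, of "\<bar>C\<^sub>0\<bar> * 2 powr A"] by simp
      also have "\<dots> \<le> (M + \<bar>C\<^sub>0\<bar> * 2 powr A) * t powr m" using M by (simp add: algebra_simps)
      finally show ?thesis .
    qed
  qed
qed

text \<open>Comparison with 1 / (1 + u^2), whose primitive is arctan; what matters is uniformity in
  the window and its centre.\<close>

lemma integral_gaussian_le_pi:
  "integral {a..b} (\<lambda>t::real. exp (- (t - T)\<^sup>2)) \<le> pi"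
proof (cases "a \<le> b")
  case True
  have I: "((\<lambda>t. 1 / (1 + (t - T)\<^sup>2)) has_integral (arctan (b - T) - arctan (a - T))) {a..b}"
    using True
  proof (rule fundamental_theorem_of_calculus)
    fix x
    have "((\<lambda>t. arctan (t - T)) has_real_derivative 1 / (1 + (x - T)\<^sup>2)) (at x within {a..b})"
      by (auto intro!: derivative_eq_intros simp: divide_inverse)
    then show "((\<lambda>t. arctan (t - T)) has_vector_derivative 1 / (1 + (x - T)\<^sup>2)) (at x within {a..b})"
      by (simp add: has_real_derivative_iff_has_vector_derivative)
  qed
  have "integral {a..b} (\<lambda>t. exp (- (t - T)\<^sup>2)) \<le> arctan (b - T) - arctan (a - T)"
  proof (rule has_integral_le[OF integrable_integral I])
    show "(\<lambda>t. exp (- (t - T)\<^sup>2)) integrable_on {a..b}"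
      by (intro integrable_continuous_real continuous_intros)
    fix t
    have "inverse (exp ((t - T)\<^sup>2)) \<le> inverse (1 + (t - T)\<^sup>2)"
      by (intro le_imp_inverse_le exp_ge_add_one_self) (simp add: add_pos_nonneg)
    then show "exp (- (t - T)\<^sup>2) \<le> 1 / (1 + (t - T)\<^sup>2)" by (simp add: exp_minus divide_inverse)
  qed
  also have "\<dots> \<le> pi" using arctan_ubound[of "b - T"] arctan_lbound[of "a - T"] by simp
  finally show ?thesis .
qed simp

text \<open>Supplies the edge hypotheses of \<open>three_lines_integral\<close> from a pointwise
  bound. The factor \<open>2 powr A\<close> comes from t \<le> 2T on the window.\<close>

lemma gaussian_mean_le_powr:
  assumes F: "F holomorphic_on {s. Im s > 0}" and A: "A \<ge> 0" and T: "T \<ge> 2"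
    and F_le: "\<And>t. t \<ge> 1 \<Longrightarrow> norm (F (Complex x t)) \<le> C * t powr A"
  shows "integral {T/2..3*T/2} (\<lambda>t. norm (F (Complex x t)) * exp (- (t - T)\<^sup>2))
           \<le> C * 2 powr A * pi * T powr A"
proof -
  have C: "C \<ge> 0" using order_trans[OF norm_ge_zero F_le[of 1]] by simp
  have cF: "continuous_on {T/2..3*T/2} (\<lambda>t. F (Complex x t))"
    using T F by (intro continuous_on_vertical) auto
  have "integral {T/2..3*T/2} (\<lambda>t. norm (F (Complex x t)) * exp (- (t - T)\<^sup>2))
      \<le> integral {T/2..3*T/2} (\<lambda>t. C * (2 * T) powr A * exp (- (t - T)\<^sup>2))"
  proof (rule integral_le)
    fix t assume t: "t \<in> {T/2..3*T/2}"
    have "norm (F (Complex x t)) \<le> C * t powr A" using t T by (intro F_le) auto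
    also have "\<dots> \<le> C * (2 * T) powr A" using C A t T by (intro mult_left_mono powr_mono2) auto
    finally show "norm (F (Complex x t)) * exp (- (t - T)\<^sup>2) \<le> C * (2 * T) powr A * exp (- (t - T)\<^sup>2)"
      by (intro mult_right_mono) auto
  qed (intro integrable_continuous_real continuous_intros cF)+
  also have "\<dots> = C * (2 * T) powr A * integral {T/2..3*T/2} (\<lambda>t. exp (- (t - T)\<^sup>2))" by simp
  also have "\<dots> \<le> C * (2 * T) powr A * pi"
    using C by (intro mult_left_mono integral_gaussian_le_pi) auto
  also have "\<dots> = C * 2 powr A * pi * T powr A" using T by (simp add: powr_mult)
  finally show ?thesis .
qed

section \<open>The order function and the abscissae\<close>

lemma order_function_ex_bound:
  assumes "polynomially_bounded_in_strips f"
  obtains m C where "m \<ge> 0" "\<forall>t\<ge>1. norm (f (Complex \<sigma> t)) \<le> C * t powr m"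
proof -
  obtain C A where CA: "\<And>t. t \<ge> 1 \<Longrightarrow> norm (f (Complex \<sigma> t)) \<le> C * t powr A"
    using assms unfolding polynomially_bounded_in_strips_def
    by (metis atLeastAtMost_iff order_refl)
  have C: "C \<ge> 0" using order_trans[OF norm_ge_zero CA[of 1]] by simp
  \<comment> \<open>The strip exponent may be negative, while the order function admits only
    exponents m \<ge> 0.\<close>
  have "norm (f (Complex \<sigma> t)) \<le> C * t powr \<bar>A\<bar>" if "t \<ge> 1" for t
  proof -
    have "C * t powr A \<le> C * t powr \<bar>A\<bar>"
      using C that by (intro mult_left_mono powr_mono) auto
    with CA[OF that] show ?thesis by linarith
  qed
  then show ?thesis using that[of "\<bar>A\<bar>" C] by auto
qed

lemma order_function_nonneg:
  assumes "polynomially_bounded_in_strips f"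
  shows "order_function f \<sigma> \<ge> 0"
proof -
  obtain m C where "m \<ge> 0" "\<forall>t\<ge>1. norm (f (Complex \<sigma> t)) \<le> C * t powr m"
    using order_function_ex_bound[OF assms] .
  then show ?thesis
    unfolding order_function_def by (intro cInf_greatest) auto
qed

lemma order_function_le:
  assumes "m \<ge> 0" "\<And>t. t \<ge> 1 \<Longrightarrow> norm (f (Complex \<sigma> t)) \<le> C * t powr m"
  shows "order_function f \<sigma> \<le> m"
  unfolding order_function_def
  by (rule cInf_lower) (use assms in \<open>auto intro!: bdd_belowI[of _ 0]\<close>)

text \<open>Admissible exponents are closed upwards because t \<ge> 1. The infimum itself need not
  be admissible, hence the strict inequality.\<close>

lemma order_function_less_imp_bound:
  assumes "polynomially_bounded_in_strips f" "order_function f \<sigma> < m"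
  obtains C where "C \<ge> 0" "\<And>t. t \<ge> 1 \<Longrightarrow> norm (f (Complex \<sigma> t)) \<le> C * t powr m"
proof -
  let ?S = "{m. m \<ge> 0 \<and> (\<exists>C. \<forall>t\<ge>1. norm (f (Complex \<sigma> t)) \<le> C * t powr m)}"
  obtain m\<^sub>0 C\<^sub>0 where "m\<^sub>0 \<ge> 0" "\<forall>t\<ge>1. norm (f (Complex \<sigma> t)) \<le> C\<^sub>0 * t powr m\<^sub>0"
    using order_function_ex_bound[OF assms(1)] .
  then have "?S \<noteq> {}" by auto
  with assms(2) obtain m' C where m': "m' < m" and C: "\<And>t. t \<ge> 1 \<Longrightarrow> norm (f (Complex \<sigma> t)) \<le> C * t powr m'"
    using cInf_lessD[of ?S m] unfolding order_function_def by blast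
  have C0: "C \<ge> 0" using order_trans[OF norm_ge_zero C[of 1]] by simp
  have "norm (f (Complex \<sigma> t)) \<le> C * t powr m" if "t \<ge> 1" for t
  proof -
    have "C * t powr m' \<le> C * t powr m"
      using C0 m' that by (intro mult_left_mono powr_mono) auto
    with C[OF that] show ?thesis by linarith
  qed
  with C0 that show ?thesis by blast
qed

theorem convex_order_function:
  assumes f: "f holomorphic_on {s. Im s > 0}" and poly: "polynomially_bounded_in_strips f"
  shows "convex_on UNIV (order_function f)"
proof (rule convex_on_linorderI)
  fix t x y :: real
  assume t: "0 < t" "t < 1" and xy: "x < y"
  define \<sigma> where "\<sigma> = (1 - t) * x + t * y"
  have \<sigma>x: "\<sigma> - x = t * (y - x)" and \<sigma>y: "y - \<sigma> = (1 - t) * (y - x)"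
    by (simp_all add: \<sigma>_def algebra_simps)
  have \<sigma>: "x < \<sigma>" "\<sigma> < y" using t xy \<sigma>x \<sigma>y by (smt (verit) mult_pos_pos)+
  have "order_function f \<sigma> \<le> (1 - t) * order_function f x + t * order_function f y + \<delta>"
    if \<delta>: "\<delta> > 0" for \<delta>
  proof -
    define A\<^sub>1 where "A\<^sub>1 = order_function f x + \<delta>"
    define A\<^sub>2 where "A\<^sub>2 = order_function f y + \<delta>"
    define m where "m = (1 - t) * A\<^sub>1 + t * A\<^sub>2"
    \<comment> \<open>Minus the slope of the chord: both tilted edge exponents then equal the chord
      value \<open>m\<close>.\<close>
    define k where "k = (A\<^sub>1 - A\<^sub>2) / (y - x)"
    have pos: "A\<^sub>1 \<ge> 0" "A\<^sub>2 \<ge> 0"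
      using order_function_nonneg[OF poly] \<delta> by (simp_all add: A\<^sub>1_def A\<^sub>2_def add_nonneg_nonneg)
    have m: "m \<ge> 0" using pos t by (simp add: m_def)
    obtain C\<^sub>1 where C1: "\<And>t. t \<ge> 1 \<Longrightarrow> norm (f (Complex x t)) \<le> C\<^sub>1 * t powr A\<^sub>1"
      using order_function_less_imp_bound[OF poly, of x A\<^sub>1] \<delta> by (auto simp: A\<^sub>1_def)
    obtain C\<^sub>2 where C2: "\<And>t. t \<ge> 1 \<Longrightarrow> norm (f (Complex y t)) \<le> C\<^sub>2 * t powr A\<^sub>2"
      using order_function_less_imp_bound[OF poly, of y A\<^sub>2] \<delta> by (auto simp: A\<^sub>2_def)
    obtain C\<^sub>0 A\<^sub>0 where C0: "\<And>u t. u \<in> {x..y} \<Longrightarrow> t \<ge> 1 \<Longrightarrow> norm (f (Complex u t)) \<le> C\<^sub>0 * t powr A\<^sub>0"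
      using poly unfolding polynomially_bounded_in_strips_def by metis
    have kxy: "k * (y - x) = A\<^sub>1 - A\<^sub>2" using xy by (simp add: k_def)
    have "x - \<sigma> = (y - x) * - t" "y - \<sigma> = (y - x) * (1 - t)"
      using \<sigma>x \<sigma>y by (simp_all add: algebra_simps)
    then have "k * (x - \<sigma>) = (A\<^sub>1 - A\<^sub>2) * - t" "k * (y - \<sigma>) = (A\<^sub>1 - A\<^sub>2) * (1 - t)"
      by (simp_all only: kxy mult.assoc[symmetric])
    then have "A\<^sub>1 + k * (x - \<sigma>) \<le> m" "A\<^sub>2 + k * (y - \<sigma>) \<le> m"
      by (simp_all add: m_def algebra_simps)
    then obtain C where "\<forall>t\<ge>1. norm (f (Complex \<sigma> t)) \<le> C * t powr m"
      using three_lines_integral[OF f \<sigma> C0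
          gaussian_mean_le_powr[OF f pos(1) _ C1] gaussian_mean_le_powr[OF f pos(2) _ C2] _ _ m]
      by blast
    then have "order_function f \<sigma> \<le> m" using m by (intro order_function_le) auto
    then show ?thesis by (simp add: m_def A\<^sub>1_def A\<^sub>2_def algebra_simps)
  qed
  then have "order_function f \<sigma> \<le> (1 - t) * order_function f x + t * order_function f y"
    by (rule field_le_epsilon)
  then show "order_function f ((1 - t) *\<^sub>R x + t *\<^sub>R y)
      \<le> (1 - t) * order_function f x + t * order_function f y"
    by (simp add: \<sigma>_def)
qed auto

text \<open>
  Applying the three lines bound to \<open>f ^ n\<close> with \<open>n \<le> p\<close> and
  \<open>\<bar>f\<bar> ^ n \<le> 1 + \<bar>f\<bar> powr p\<close> replaces the subharmonicity of \<open>\<bar>f\<bar> powr p\<close>.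
\<close>
lemma order_function_le_of_Lp_finite:
  assumes f: "f holomorphic_on {s. Im s > 0}" and poly: "polynomially_bounded_in_strips f"
    and \<sigma>: "x < \<sigma>" "\<sigma> < y" and y: "order_function f y = 0"
    and n: "n > 0" "real n \<le> p" and \<alpha>: "\<alpha> \<ge> 1"
    and fin: "(\<integral>\<^sup>+ t\<in>{1..}. ennreal (norm (f (Complex x t)) powr p / t powr \<alpha>) \<partial>lborel) < \<infinity>"
  shows "order_function f \<sigma> \<le> \<alpha> / n"
proof -
  define F where "F = (\<lambda>s. f s ^ n)"
  define g where "g = (\<lambda>t. norm (f (Complex x t)) powr p / t powr \<alpha>)"
  define N where "N = enn2real (\<integral>\<^sup>+ t\<in>{1..}. ennreal (g t) \<partial>lborel)"
  have N: "(\<integral>\<^sup>+ t\<in>{1..}. ennreal (g t) \<partial>lborel) = ennreal N"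
    using fin by (simp add: N_def g_def)
  have N0: "N \<ge> 0" by (simp add: N_def)
  have p: "p > 0" using n by linarith
  have F: "F holomorphic_on {s. Im s > 0}" unfolding F_def using f by (intro holomorphic_intros)
  obtain C\<^sub>0 A\<^sub>0 where C0: "\<And>u t. u \<in> {x..y} \<Longrightarrow> t \<ge> 1 \<Longrightarrow> norm (f (Complex u t)) \<le> C\<^sub>0 * t powr A\<^sub>0"
    using poly unfolding polynomially_bounded_in_strips_def by metis
  have F0: "norm (F (Complex u t)) \<le> C\<^sub>0 ^ n * t powr (real n * A\<^sub>0)" if "u \<in> {x..y}" "t \<ge> 1" for u t
  proof -
    have "norm (F (Complex u t)) = norm (f (Complex u t)) ^ n" by (simp add: F_def norm_power)
    also have "\<dots> \<le> (C\<^sub>0 * t powr A\<^sub>0) ^ n" using C0[OF that] by (intro power_mono) auto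
    finally show ?thesis using that by (simp add: power_mult_distrib powr_power mult.commute)
  qed
  \<comment> \<open>Order 0 at \<open>y\<close> makes every positive exponent admissible there;
    \<alpha> / n is the one for which \<open>F\<close> gets the same exponent \<alpha> as on the
    line through \<open>x\<close>.\<close>
  obtain c where c: "c \<ge> 0" "\<And>t. t \<ge> 1 \<Longrightarrow> norm (f (Complex y t)) \<le> c * t powr (\<alpha> / n)"
    using order_function_less_imp_bound[OF poly, of y "\<alpha> / n"] y n \<alpha> by auto
  have Fy: "norm (F (Complex y t)) \<le> c ^ n * t powr \<alpha>" if "t \<ge> 1" for t
  proof -
    have "norm (F (Complex y t)) = norm (f (Complex y t)) ^ n" by (simp add: F_def norm_power)
    also have "\<dots> \<le> (c * t powr (\<alpha> / n)) ^ n" using c(2)[OF that] by (intro power_mono) auto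
    also have "\<dots> = c ^ n * t powr \<alpha>" using that n by (simp add: power_mult_distrib powr_power)
    finally show ?thesis .
  qed
  have Fx: "integral {T/2..3*T/2} (\<lambda>t. norm (F (Complex x t)) * exp (- (t - T)\<^sup>2))
      \<le> (1 + 2 powr \<alpha> * N) * T powr \<alpha>" if T: "T \<ge> 2" for T
  proof -
    let ?I = "{T/2..3*T/2}"
    have cf: "continuous_on ?I (\<lambda>t. f (Complex x t))" "continuous_on ?I (\<lambda>t. F (Complex x t))"
      using T f F by (auto intro!: continuous_on_vertical)
    have cg: "continuous_on ?I g"
      unfolding g_def using T p by (intro continuous_intros continuous_on_powr' cf) auto
    have gI: "(g has_integral integral ?I g) ?I"
      using cg by (intro integrable_integral integrable_continuous_real)
    have g0: "g t \<ge> 0" for t by (simp add: g_def)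
    have "ennreal (integral ?I g) = (\<integral>\<^sup>+ t. ennreal (g t) * indicator ?I t \<partial>lborel)"
      using nn_integral_has_integral_lebesgue'[OF g0 gI] by simp
    also have "\<dots> \<le> (\<integral>\<^sup>+ t\<in>{1..}. ennreal (g t) \<partial>lborel)"
      using T by (intro nn_integral_mono mult_left_mono) (auto simp: indicator_def)
    finally have gN: "integral ?I g \<le> N" using N N0 by simp
    have "integral ?I (\<lambda>t. norm (F (Complex x t)) * exp (- (t - T)\<^sup>2))
        \<le> integral ?I (\<lambda>t. 1 + (2 * T) powr \<alpha> * g t)"
    proof (rule integral_le)
      fix t assume t: "t \<in> ?I"
      let ?z = "norm (f (Complex x t))"
      have "norm (F (Complex x t)) * exp (- (t - T)\<^sup>2) \<le> ?z ^ n * 1"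
        by (intro mult_mono) (auto simp: F_def norm_power)
      also have "?z ^ n \<le> 1 + ?z powr p"
      proof (cases "?z \<le> 1")
        case True
        then show ?thesis by (smt (verit) norm_ge_zero power_le_one powr_ge_zero)
      next
        case False
        then have "?z ^ n = ?z powr n" using powr_realpow[of ?z n] by linarith
        also have "\<dots> \<le> ?z powr p" using False n by (intro powr_mono) auto
        finally show ?thesis by simp
      qed
      \<comment> \<open>Removing the weight from \<open>g\<close> costs at most (2T) powr \<alpha>
        on the window, which is the origin of the exponent \<alpha>.\<close>
      also have "?z powr p = t powr \<alpha> * g t" using t T by (simp add: g_def)
      also have "t powr \<alpha> * g t \<le> (2 * T) powr \<alpha> * g t"
        using t T \<alpha> g0 by (intro mult_right_mono powr_mono2) auto
      finally show "norm (F (Complex x t)) * exp (- (t - T)\<^sup>2) \<le> 1 + (2 * T) powr \<alpha> * g t" by simp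
    qed (intro integrable_continuous_real continuous_intros cf cg)+
    \<comment> \<open>The window has length T, so the summand 1 contributes T; this is absorbed
      below because \<alpha> \<ge> 1.\<close>
    also have "\<dots> = T + (2 * T) powr \<alpha> * integral ?I g"
      using integral_add[of "\<lambda>_. 1" ?I "\<lambda>t. (2 * T) powr \<alpha> * g t"] T gI
      by (auto intro!: integrable_on_mult_right simp: integrable_on_def)
    also have "\<dots> \<le> T powr \<alpha> + (2 * T) powr \<alpha> * N"
    proof (intro add_mono mult_left_mono gN)
      show "T \<le> T powr \<alpha>" using powr_mono[of 1 \<alpha> T] \<alpha> T by simp
    qed auto
    also have "\<dots> = (1 + 2 powr \<alpha> * N) * T powr \<alpha>" using T by (simp add: powr_mult algebra_simps)
    finally show ?thesis .
  qed
  have \<alpha>0: "\<alpha> \<ge> 0" using \<alpha> by simp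
  \<comment> \<open>Both edges carry the exponent \<alpha>, so the slope is 0.\<close>
  obtain C where C: "\<forall>t\<ge>1. norm (F (Complex \<sigma> t)) \<le> C * t powr \<alpha>"
    using three_lines_integral[OF F \<sigma> F0 Fx gaussian_mean_le_powr[OF F \<alpha>0 _ Fy], of 0 \<alpha>] \<alpha>0 by auto
  have C_nonneg: "C \<ge> 0" using order_trans[OF norm_ge_zero C[rule_format, of 1]] by simp
  show ?thesis
  proof (rule order_function_le)
    fix t :: real assume t: "t \<ge> 1"
    have "norm (f (Complex \<sigma> t)) ^ n \<le> C * t powr \<alpha>"
      using C t by (simp add: F_def norm_power)
    also have "\<dots> = (root n C * t powr (\<alpha> / n)) ^ n"
      using C_nonneg n t by (simp add: power_mult_distrib powr_power)
    finally show "norm (f (Complex \<sigma> t)) \<le> root n C * t powr (\<alpha> / n)"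
      using C_nonneg n by (subst (asm) power_mono_iff) auto
  qed (use \<alpha>0 in simp)
qed

text \<open>For m slightly above the order, the integrand is dominated by a multiple of t powr (m p
  - \<alpha>), which is integrable at infinity as soon as m p - \<alpha> < -1.\<close>

lemma Lp_finite_of_order_function_less:
  assumes poly: "polynomially_bounded_in_strips f" and p: "p > 0"
    and less: "order_function f \<sigma> * p < \<alpha> - 1"
    and f: "f holomorphic_on {s. Im s > 0}"
  shows "(\<integral>\<^sup>+ t\<in>{1..}. ennreal (norm (f (Complex \<sigma> t)) powr p / t powr \<alpha>) \<partial>lborel) < \<infinity>"
proof -
  have "order_function f \<sigma> < (\<alpha> - 1) / p" using less p by (simp add: field_simps)
  then obtain m where m: "order_function f \<sigma> < m" "m < (\<alpha> - 1) / p" using dense by blast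
  obtain C where C: "C \<ge> 0" "\<And>t. t \<ge> 1 \<Longrightarrow> norm (f (Complex \<sigma> t)) \<le> C * t powr m"
    using order_function_less_imp_bound[OF poly m(1)] by blast
  define e where "e = m * p - \<alpha>"
  have e: "e < -1" using m(2) p by (simp add: e_def field_simps)
  have "((\<lambda>t. C powr p * t powr e) has_integral C powr p * (- (1 powr (e + 1)) / (e + 1))) {1..}"
    by (intro has_integral_mult_right has_integral_powr_to_inf e) auto
  then have I: "(\<integral>\<^sup>+ t. ennreal (C powr p * t powr e) * indicator {1..} t \<partial>lborel) < \<infinity>"
    by (subst nn_integral_has_integral_lebesgue') auto
  have "(\<integral>\<^sup>+ t\<in>{1..}. ennreal (norm (f (Complex \<sigma> t)) powr p / t powr \<alpha>) \<partial>lborel)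
      \<le> (\<integral>\<^sup>+ t. ennreal (C powr p * t powr e) * indicator {1..} t \<partial>lborel)"
  proof (intro nn_integral_mono)
    fix t :: real
    show "ennreal (norm (f (Complex \<sigma> t)) powr p / t powr \<alpha>) * indicator {1..} t
        \<le> ennreal (C powr p * t powr e) * indicator {1..} t"
    proof (cases "t \<ge> 1")
      case True
      have "norm (f (Complex \<sigma> t)) powr p \<le> (C * t powr m) powr p"
        using C(2)[OF True] p by (intro powr_mono2) auto
      also have "\<dots> = C powr p * t powr (m * p)" using C(1) by (simp add: powr_mult powr_powr)
      finally have "norm (f (Complex \<sigma> t)) powr p / t powr \<alpha> \<le> C powr p * t powr (m * p) / t powr \<alpha>"
        by (intro divide_right_mono) auto
      also have "\<dots> = C powr p * t powr e" by (simp add: e_def powr_diff)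
      finally show ?thesis using True by (simp add: ennreal_leI)
    qed simp
  qed
  with I show ?thesis by (rule le_less_trans[rotated])
qed

lemma Lp_abscissa_le:
  assumes "f holomorphic_on {s. Im s > 0}" "polynomially_bounded_in_strips f"
    and "a \<le> \<sigma>" "\<sigma> \<le> 1" "p > 0" "order_function f \<sigma> * p < \<alpha> - 1"
  shows "Lp_abscissa f a p \<alpha> \<le> \<sigma>"
  unfolding Lp_abscissa_def
  using assms Lp_finite_of_order_function_less[OF assms(2,5,6,1)]
  by (intro cInf_lower) (auto intro!: bdd_belowI[of _ a])

text \<open>Finiteness at some x < \<tau> would give order at most \<alpha> / n at \<tau>, where n
  is p rounded down; the factor p - 1 pays for the rounding.\<close>

lemma le_Lp_abscissa:
  assumes f: "f holomorphic_on {s. Im s > 0}" and poly: "polynomially_bounded_in_strips f"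
    and \<mu>1: "order_function f 1 = 0" and a: "a \<le> 1" and p: "p > 0" and \<alpha>: "\<alpha> > 1"
    and \<tau>: "\<tau> < 1" "\<alpha> < (p - 1) * order_function f \<tau>"
  shows "\<tau> \<le> Lp_abscissa f a p \<alpha>"
  unfolding Lp_abscissa_def
proof (rule cInf_greatest)
  \<comment> \<open>The infimum of an empty set would carry no information; the point 1 is a member
    because the order there is 0.\<close>
  show "{\<sigma> \<in> {a..1}. (\<integral>\<^sup>+ t\<in>{1..}. ennreal (norm (f (Complex \<sigma> t)) powr p / t powr \<alpha>) \<partial>lborel) < \<infinity>} \<noteq> {}"
    using Lp_finite_of_order_function_less[OF poly p _ f, of 1 \<alpha>] \<mu>1 a \<alpha> by auto
next
  fix x
  assume x: "x \<in> {\<sigma> \<in> {a..1}. (\<integral>\<^sup>+ t\<in>{1..}. ennreal (norm (f (Complex \<sigma> t)) powr p / t powr \<alpha>) \<partial>lborel) < \<infinity>}"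
  show "\<tau> \<le> x"
  proof (rule ccontr)
    assume "\<not> \<tau> \<le> x"
    define n where "n = nat \<lfloor>p\<rfloor>"
    have n: "p - 1 \<le> real n" "real n \<le> p" using p by (simp_all add: n_def)
    have "(p - 1) * order_function f \<tau> \<le> n * order_function f \<tau>"
      using n order_function_nonneg[OF poly] by (intro mult_right_mono) auto
    with \<tau> have *: "\<alpha> < n * order_function f \<tau>" by linarith
    then have "n > 0" using \<alpha> by (cases n) auto
    then have "order_function f \<tau> \<le> \<alpha> / n"
      using \<open>\<not> \<tau> \<le> x\<close> x \<tau> \<alpha> n \<mu>1 by (intro order_function_le_of_Lp_finite[OF f poly, of x _ 1]) auto
    with * \<open>n > 0\<close> show False by (simp add: field_simps)
  qed
qed

section \<open>Convexity of the reciprocal of the order function\<close>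

lemma convex_on_nonneg_strict_antimono:
  fixes m :: "real \<Rightarrow> real"
  assumes conv: "convex_on UNIV m" and "m 1 = 0" and nonneg: "\<And>x. m x \<ge> 0"
    and "y < x" "x < 1" and pos: "m x > 0"
  shows "m x < m y"
proof -
  define t where "t = (x - y) / (1 - y)"
  have t: "0 < t" "t < 1" using assms by (simp_all add: t_def)
  have "t * (1 - y) = x - y" using assms by (simp add: t_def)
  \<comment> \<open>The chord from y ends in the zero at 1, so it lies strictly below its value at
    y.\<close>
  then have "(1 - t) * y + t * 1 = x" by (simp add: algebra_simps)
  then have *: "m x \<le> (1 - t) * m y"
    using convex_onD[OF conv, of t y 1] t \<open>m 1 = 0\<close> by simp
  with pos have "0 < (1 - t) * m y" by linarith
  then have "m y > 0" using t by (simp add: zero_less_mult_iff)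
  then have "(1 - t) * m y < m y" using t by simp
  with * show ?thesis by linarith
qed

lemma eventually_less_mult_at_top:
  fixes c K :: real
  assumes "c > 0"
  shows "eventually (\<lambda>l. K < l * c) at_top"
  using eventually_gt_at_top[of "K / c"] by eventually_elim (use assms in \<open>simp add: field_simps\<close>)

text \<open>
  For \<open>\<alpha> = l\<close> and \<open>p = l / \<mu> \<sigma>\<close> with \<open>l\<close> large, the abscissa \<open>\<sigma>\<^sub>p(\<alpha>)\<close> is close to
  \<open>\<sigma>\<close>. Approximate concavity hence says that the inverse function of \<open>1 / \<mu>\<close>, which is
  increasing, is concave.
\<close>
theorem convex_on_inverse_order_function:
  assumes f: "f holomorphic_on {s. Im s > 0}" and poly: "polynomially_bounded_in_strips f"
    and conc: "approx_concave f" and \<mu>1: "order_function f 1 = 0"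
    and b: "b \<le> 1" "\<And>\<sigma>. \<sigma> < b \<Longrightarrow> order_function f \<sigma> > 0"
  shows "convex_on {..<b} (\<lambda>\<sigma>. 1 / order_function f \<sigma>)"
proof (rule convex_on_linorderI)
  fix t x y :: real
  assume t: "0 < t" "t < 1" and xyb: "x \<in> {..<b}" "y \<in> {..<b}" and xy: "x < y"
  define \<mu> where "\<mu> = order_function f"
  define s where "s = (1 - t) * x + t * y"
  define Y where "Y = (1 - t) * (1 / \<mu> x) + t * (1 / \<mu> y)"
  have \<mu>_conv: "convex_on UNIV \<mu>" unfolding \<mu>_def by (rule convex_order_function[OF f poly])
  have \<mu>_pos: "\<mu> x > 0" "\<mu> y > 0" using xyb b by (auto simp: \<mu>_def)
  have \<mu>_anti: "\<mu> v < \<mu> u" if "u < v" "v < b" for u v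
    using that b \<mu>1 order_function_nonneg[OF poly]
    by (intro convex_on_nonneg_strict_antimono[OF \<mu>_conv]) (auto simp: \<mu>_def)
  have Y: "Y > 0" using t \<mu>_pos by (simp add: Y_def add_pos_pos)
  have "s - x = t * (y - x)" "y - s = (1 - t) * (y - x)" by (simp_all add: s_def algebra_simps)
  then have s: "x < s" "s < y" using t xy by (smt (verit) mult_pos_pos)+
  have "1 / \<mu> s \<le> Y"
  proof (rule ccontr)
    assume "\<not> 1 / \<mu> s \<le> Y"
    moreover have "\<mu> s > 0" using s xyb b by (auto simp: \<mu>_def)
    ultimately have "\<mu> s < 1 / Y" using Y by (simp add: field_simps)
    moreover have "continuous_on UNIV \<mu>" using \<mu>_conv by (intro convex_on_continuous) auto
    then have "(\<mu> \<longlongrightarrow> \<mu> s) (at_left s)"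
      using continuous_on_eq_continuous_at continuous_within filterlim_at_split open_UNIV by blast
    ultimately have "eventually (\<lambda>\<tau>. \<mu> \<tau> < 1 / Y) (at_left s)"
      by (rule order_tendstoD(2)[rotated])
    moreover have "eventually (\<lambda>\<tau>. \<tau> \<in> {x<..<s}) (at_left s)"
      by (rule eventually_at_leftI[OF _ s(1)]) auto
    ultimately have "eventually (\<lambda>\<tau>. \<mu> \<tau> < 1 / Y \<and> \<tau> \<in> {x<..<s}) (at_left s)"
      by (rule eventually_conj)
    \<comment> \<open>The failure of convexity at \<open>s\<close> persists slightly to the left of
      \<open>s\<close>, and the gap s - \<tau> = 3\<delta> drives the contradiction: one \<delta>
      goes to the lower bounds for the abscissae, one to approximate concavity, and one is left
      over.\<close>
    then obtain \<tau> where \<tau>: "\<mu> \<tau> < 1 / Y" "x < \<tau>" "\<tau> < s"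
      using eventually_happens'[OF trivial_limit_at_left_real] by auto
    define \<delta> where "\<delta> = (s - \<tau>) / 3"
    have \<delta>: "\<delta> > 0" using \<tau> by (simp add: \<delta>_def)
    \<comment> \<open>The strip starts at \<open>x\<close> itself: for \<alpha> = l and q = l /
      \<mu> x \<le> r the constraint on \<alpha> then holds with equality.\<close>
    have "approx_concave_on_strip f x"
      using conc xyb b \<mu>_pos unfolding approx_concave_def \<mu>_def by auto
    then obtain P where P: "\<And>q r \<phi> \<alpha>. q > 0 \<Longrightarrow> r > 0 \<Longrightarrow> \<phi> \<in> {0..1} \<Longrightarrow>
        \<phi> * q + (1 - \<phi>) * r \<ge> P \<Longrightarrow> 1 < \<alpha> \<Longrightarrow> \<alpha> \<le> \<mu> x * min q r \<Longrightarrow>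
        \<phi> * Lp_abscissa f x q \<alpha> + (1 - \<phi>) * Lp_abscissa f x r \<alpha>
          \<le> Lp_abscissa f x (\<phi> * q + (1 - \<phi>) * r) \<alpha> + \<delta>"
      using \<delta> unfolding approx_concave_on_strip_def \<mu>_def by meson
    \<comment> \<open>By strict decrease \<mu> (z - \<delta>) / \<mu> z exceeds 1, so the gain is
      linear in \<open>l\<close> and beats the constant lost in p - 1.\<close>
    have low: "eventually (\<lambda>l. l < (l / \<mu> z - 1) * \<mu> (z - \<delta>)) at_top" if "\<mu> z > 0" "z < b" for z
    proof -
      have "\<mu> (z - \<delta>) / \<mu> z - 1 > 0" using \<mu>_anti[of "z - \<delta>" z] that \<delta> by simp
      from eventually_less_mult_at_top[OF this, of "\<mu> (z - \<delta>)"] show ?thesis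
        by eventually_elim (use that in \<open>simp add: field_simps\<close>)
    qed
    \<comment> \<open>This is the finiteness condition \<mu> \<tau> * p < l - 1 for the mixed
      exponent p = l Y.\<close>
    have "eventually (\<lambda>l. 1 < l * (1 - Y * \<mu> \<tau>)) at_top"
      using \<tau>(1) Y by (intro eventually_less_mult_at_top) (simp add: field_simps)
    moreover have "eventually (\<lambda>l. P < l * Y) at_top" by (rule eventually_less_mult_at_top[OF Y])
    moreover have "eventually (\<lambda>l::real. l > 1) at_top" by (rule eventually_gt_at_top)
    moreover have "eventually (\<lambda>l. l < (l / \<mu> x - 1) * \<mu> (x - \<delta>)) at_top"
      using low \<mu>_pos xyb by simp
    moreover have "eventually (\<lambda>l. l < (l / \<mu> y - 1) * \<mu> (y - \<delta>)) at_top"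
      using low \<mu>_pos xyb by simp
    ultimately have "eventually (\<lambda>l. 1 < l * (1 - Y * \<mu> \<tau>) \<and> P < l * Y \<and> l > 1 \<and>
        l < (l / \<mu> x - 1) * \<mu> (x - \<delta>) \<and> l < (l / \<mu> y - 1) * \<mu> (y - \<delta>)) at_top"
      by eventually_elim auto
    then obtain l where l: "1 < l * (1 - Y * \<mu> \<tau>)" "P < l * Y" "l > 1"
        "l < (l / \<mu> x - 1) * \<mu> (x - \<delta>)" "l < (l / \<mu> y - 1) * \<mu> (y - \<delta>)"
      using eventually_happens'[OF trivial_limit_at_top_linorder] by auto
    define q where "q = l / \<mu> x"
    define r where "r = l / \<mu> y"
    have qr: "q > 0" "r > 0" using l \<mu>_pos by (simp_all add: q_def r_def)
    have mix: "(1 - t) * q + (1 - (1 - t)) * r = l * Y"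
      by (simp add: q_def r_def Y_def algebra_simps)
    have "q \<le> r" using l \<mu>_pos \<mu>_anti[OF xy] xyb by (auto simp: q_def r_def intro!: divide_left_mono)
    then have "l \<le> \<mu> x * min q r" using \<mu>_pos by (simp add: q_def)
    then have "(1 - t) * Lp_abscissa f x q l + (1 - (1 - t)) * Lp_abscissa f x r l
        \<le> Lp_abscissa f x (l * Y) l + \<delta>"
      using P[of q r "1 - t" l] qr t l unfolding mix by auto
    moreover have "Lp_abscissa f x (l * Y) l \<le> \<tau>"
    proof (rule Lp_abscissa_le[OF f poly])
      show "order_function f \<tau> * (l * Y) < l - 1" using l(1) by (simp add: \<mu>_def algebra_simps)
    qed (use \<tau> s xyb b l Y in auto)
    moreover have "x - \<delta> \<le> Lp_abscissa f x q l"
      using l qr xyb b \<delta> \<mu>1 by (intro le_Lp_abscissa[OF f poly]) (auto simp: q_def \<mu>_def)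
    then have "(1 - t) * (x - \<delta>) \<le> (1 - t) * Lp_abscissa f x q l"
      using t by (intro mult_left_mono) auto
    moreover have "y - \<delta> \<le> Lp_abscissa f x r l"
      using l qr xyb b \<delta> \<mu>1 by (intro le_Lp_abscissa[OF f poly]) (auto simp: r_def \<mu>_def)
    then have "(1 - (1 - t)) * (y - \<delta>) \<le> (1 - (1 - t)) * Lp_abscissa f x r l"
      using t by (intro mult_left_mono) auto
    ultimately have "(1 - t) * (x - \<delta>) + (1 - (1 - t)) * (y - \<delta>) \<le> \<tau> + \<delta>" by linarith
    then have "s - \<delta> \<le> \<tau> + \<delta>" by (simp add: s_def algebra_simps)
    then show False using \<tau> by (simp add: \<delta>_def field_simps)
  qed
  then show "1 / order_function f ((1 - t) *\<^sub>R x + t *\<^sub>R y)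
      \<le> (1 - t) * (1 / order_function f x) + t * (1 / order_function f y)"
    by (simp add: s_def Y_def \<mu>_def)
qed auto

section \<open>Differentiability from convexity of a function and of its reciprocal\<close>

lemma has_real_derivative_squeeze:
  fixes h L U :: "real \<Rightarrow> real"
  assumes ev: "eventually (\<lambda>y. L y \<le> h y \<and> h y \<le> U y) (nhds x)"
    and eq: "L x = h x" "U x = h x"
    and L: "(L has_real_derivative l) (at x)" and U: "(U has_real_derivative u) (at x)"
  shows "(h has_real_derivative l) (at x)"
proof -
  obtain d where d: "d > 0" "\<And>y. dist y x < d \<Longrightarrow> L y \<le> h y \<and> h y \<le> U y"
    using ev unfolding eventually_nhds_metric by blast
  \<comment> \<open>The gap between the barriers has a local minimum at x, so their slopes
    agree.\<close>
  have "((\<lambda>y. U y - L y) has_real_derivative (u - l)) (at x)"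
    using U L by (rule DERIV_diff)
  then have "u - l = 0"
    by (rule DERIV_local_min[OF _ d(1)]) (use d eq in \<open>fastforce simp: dist_real_def abs_minus_commute\<close>)
  then have [simp]: "u = l" by simp
  let ?q = "\<lambda>k y. (k y - k x) / (y - x)"
  \<comment> \<open>Division by y - x reverses the order to the left of x; the sum of both errors
    dominates on either side.\<close>
  have lim: "((\<lambda>y. \<bar>?q L y - l\<bar> + \<bar>?q U y - l\<bar>) \<longlongrightarrow> \<bar>l - l\<bar> + \<bar>l - l\<bar>) (at x)"
    using L U by (intro tendsto_intros) (simp_all add: has_field_derivative_iff)
  have "((\<lambda>y. ?q h y - l) \<longlongrightarrow> 0) (at x)"
  proof (rule Lim_null_comparison)
    have "eventually (\<lambda>y. L y \<le> h y \<and> h y \<le> U y) (at x)"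
      using ev by (simp add: eventually_nhds_conv_at)
    then show "eventually (\<lambda>y. norm (?q h y - l) \<le> \<bar>?q L y - l\<bar> + \<bar>?q U y - l\<bar>) (at x)"
    proof eventually_elim
      case (elim y)
      have "?q L y \<le> ?q h y \<and> ?q h y \<le> ?q U y \<or> ?q U y \<le> ?q h y \<and> ?q h y \<le> ?q L y"
      proof (cases "y \<ge> x")
        case True
        then show ?thesis using elim eq by (intro disjI1 conjI divide_right_mono) auto
      next
        case False
        then show ?thesis using elim eq by (intro disjI2 conjI divide_right_mono_neg) auto
      qed
      then show ?case unfolding real_norm_def by linarith
    qed
  qed (use lim in simp)
  then show ?thesis by (simp add: has_field_derivative_iff LIM_zero_iff)
qed

lemma convex_on_ex_supporting_line:
  fixes h :: "real \<Rightarrow> real"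
  assumes "convex_on I h" "open I" "x \<in> I"
  obtains c where "\<And>y. y \<in> I \<Longrightarrow> h x + c * (y - x) \<le> h y"
  using convex_le_Inf_differential[OF assms(1)] assms(2,3) by (metis interior_open)

text \<open>At a corner of a convex function the slope jumps up. Taking the reciprocal of a positive
  function turns this into a jump down, which convexity of the reciprocal rules out.\<close>

lemma differentiable_of_convex_inverse:
  fixes m :: "real \<Rightarrow> real"
  assumes conv: "convex_on I m" and inv: "convex_on I (\<lambda>x. 1 / m x)" and I: "open I" "x \<in> I"
    and pos: "\<And>y. y \<in> I \<Longrightarrow> m y > 0"
  shows "m differentiable (at x)"
proof -
  obtain c where c: "\<And>y. y \<in> I \<Longrightarrow> m x + c * (y - x) \<le> m y"
    using convex_on_ex_supporting_line[OF conv I] by blast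
  obtain e where e: "\<And>y. y \<in> I \<Longrightarrow> 1 / m x + e * (y - x) \<le> 1 / m y"
    using convex_on_ex_supporting_line[OF inv I] by blast
  let ?V = "\<lambda>y. 1 / m x + e * (y - x)"
  have mx: "m x > 0" using pos I by simp
  have V: "((\<lambda>y. 1 / ?V y) has_real_derivative - e * (m x)\<^sup>2) (at x)"
    using mx by (auto intro!: derivative_eq_intros simp: power2_eq_square)
  \<comment> \<open>The supporting line of 1/m inverts to an upper barrier for m only where it is
    positive, hence only near x.\<close>
  have "(?V \<longlongrightarrow> 1 / m x + e * (x - x)) (nhds x)"
    by (intro tendsto_intros filterlim_ident)
  then have "eventually (\<lambda>y. ?V y > 0) (nhds x)"
    by (rule order_tendstoD(1)) (use mx in simp)
  moreover have "eventually (\<lambda>y. y \<in> I) (nhds x)" using I by (rule eventually_nhds_in_open)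
  ultimately have ev: "eventually (\<lambda>y. m x + c * (y - x) \<le> m y \<and> m y \<le> 1 / ?V y) (nhds x)"
  proof eventually_elim
    case (elim y)
    have "?V y * m y \<le> 1" using e[OF elim(2)] pos[OF elim(2)] by (simp add: pos_le_divide_eq)
    then have "m y \<le> 1 / ?V y" using elim(1) by (simp add: pos_le_divide_eq mult.commute)
    with c[OF elim(2)] show ?case by simp
  qed
  have L: "((\<lambda>y. m x + c * (y - x)) has_real_derivative c) (at x)"
    by (auto intro!: derivative_eq_intros)
  have "(m has_real_derivative c) (at x)"
    by (rule has_real_derivative_squeeze[OF ev _ _ L V]) simp_all
  then show ?thesis using real_differentiable_def by blast
qed

section \<open>The main theorem\<close>

text \<open>Shows that the definite description denotes. The witness is the infimum of the zero set,
  which is closed by continuity and bounded below by \<open>c\<close>; strict decrease at positive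
  values prevents \<mu> from becoming positive again after a zero.\<close>

lemma order_threshold_properties:
  fixes f :: "complex \<Rightarrow> complex"
  defines "\<mu> \<equiv> order_function f" and "b \<equiv> order_threshold f"
  assumes f: "f holomorphic_on {s. Im s > 0}" and poly: "polynomially_bounded_in_strips f"
    and pos: "\<And>\<sigma>. \<sigma> < c \<Longrightarrow> \<mu> \<sigma> > 0" and zero: "\<And>\<sigma>. \<sigma> \<ge> 1 \<Longrightarrow> \<mu> \<sigma> = 0"
  shows "b \<le> 1" "\<And>\<sigma>. \<sigma> < b \<Longrightarrow> \<mu> \<sigma> > 0" "\<And>\<sigma>. \<sigma> \<ge> b \<Longrightarrow> \<mu> \<sigma> = 0"
proof -
  let ?P = "\<lambda>b. b \<le> 1 \<and> (\<forall>\<sigma><b. \<mu> \<sigma> > 0) \<and> (\<forall>\<sigma>\<ge>b. \<mu> \<sigma> = 0)"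
  define S where "S = {\<sigma>. \<mu> \<sigma> = 0}"
  have nonneg: "\<mu> \<sigma> \<ge> 0" for \<sigma> unfolding \<mu>_def by (rule order_function_nonneg[OF poly])
  have conv: "convex_on UNIV \<mu>" unfolding \<mu>_def by (rule convex_order_function[OF f poly])
  then have "continuous_on UNIV \<mu>" by (intro convex_on_continuous) auto
  then have "closed S" unfolding S_def by (intro closed_Collect_eq) auto
  moreover have 1: "1 \<in> S" using zero by (simp add: S_def)
  moreover have bdd: "bdd_below S"
  proof (rule bdd_belowI)
    fix x assume "x \<in> S"
    then show "c \<le> x" using pos[of x] by (cases "x < c") (auto simp: S_def)
  qed
  ultimately have InfS: "Inf S \<in> S" by (intro closed_contains_Inf) auto
  have "?P (Inf S)"
  proof (intro conjI allI impI)
    show "Inf S \<le> 1" using 1 bdd by (rule cInf_lower)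
  next
    fix \<sigma> assume "\<sigma> < Inf S"
    then have "\<sigma> \<notin> S" using bdd cInf_lower by (meson linorder_not_le)
    then show "\<mu> \<sigma> > 0" using nonneg[of \<sigma>] by (simp add: S_def)
  next
    fix \<sigma> assume \<sigma>: "\<sigma> \<ge> Inf S"
    show "\<mu> \<sigma> = 0"
    proof (rule ccontr)
      assume "\<mu> \<sigma> \<noteq> 0"
      then have "\<mu> \<sigma> > 0" using nonneg[of \<sigma>] by simp
      moreover have "\<sigma> < 1" using zero[of \<sigma>] \<open>\<mu> \<sigma> \<noteq> 0\<close> by linarith
      moreover have "\<sigma> \<noteq> Inf S" using InfS \<open>\<mu> \<sigma> \<noteq> 0\<close> unfolding S_def by blast
      then have "Inf S < \<sigma>" using \<sigma> by simp
      ultimately have "\<mu> \<sigma> < \<mu> (Inf S)"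
        by (intro convex_on_nonneg_strict_antimono[OF conv _ nonneg]) (simp_all add: zero)
      then show False using InfS nonneg[of \<sigma>] by (simp add: S_def)
    qed
  qed
  moreover have "b' = Inf S" if "?P b'" for b'
    using that \<open>?P (Inf S)\<close> by (metis less_irrefl linorder_neqE_linordered_idom order_refl)
  ultimately have "?P b"
    unfolding b_def order_threshold_def \<mu>_def by (rule theI)
  then show "b \<le> 1" "\<And>\<sigma>. \<sigma> < b \<Longrightarrow> \<mu> \<sigma> > 0" "\<And>\<sigma>. \<sigma> \<ge> b \<Longrightarrow> \<mu> \<sigma> = 0" by auto
qed

theorem mainTheorem3:
  fixes f :: "complex \<Rightarrow> complex" and d :: real and \<mu> :: "real \<Rightarrow> real" and b :: real
  defines "\<mu> \<equiv> order_function f" and "b \<equiv> order_threshold f"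
  assumes "f analytic_on {s. Im s > 0}"
    and "polynomially_bounded_in_strips f"
    and "d \<ge> 1"
    and "\<And>\<sigma>. \<mu> \<sigma> = \<mu> (1 - \<sigma>) + d * (1/2 - \<sigma>)"
    and "\<And>\<sigma>. \<sigma> \<ge> 1 \<Longrightarrow> \<mu> \<sigma> = 0"
    and "approx_concave f"
    and "\<mu> differentiable (at (1/2))"
  shows "(\<forall>\<sigma>. \<mu> differentiable (at \<sigma>)) \<and>
    \<mu> (1/2) < d / 4 \<and>
    (\<forall>\<sigma>. 0 \<le> \<sigma> \<and> \<sigma> < b \<longrightarrow>
       \<mu> \<sigma> \<le> d / (2 + 4 * \<sigma>) \<and>
       d / (2 + 4 * \<sigma>) = d * (1/2 - \<sigma>) + 2 * d * \<sigma>\<^sup>2 / (1 + 2 * \<sigma>)) \<and>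
    (\<forall>\<sigma>. 1 - b < \<sigma> \<and> \<sigma> \<le> 1 \<longrightarrow> \<mu> \<sigma> \<le> 2 * d * (1 - \<sigma>)\<^sup>2)"
proof -
  note poly = assms(4) and d = assms(5) and funeq = assms(6) and zero = assms(7)
  have f: "f holomorphic_on {s. Im s > 0}" using assms(3) by (rule analytic_imp_holomorphic)
  have nonneg: "\<mu> \<sigma> \<ge> 0" for \<sigma> unfolding \<mu>_def by (rule order_function_nonneg[OF poly])
  have conv: "convex_on UNIV \<mu>" unfolding \<mu>_def by (rule convex_order_function[OF f poly])
  have left_pos: "\<mu> \<sigma> > 0" if "\<sigma> < 1/2" for \<sigma>
    unfolding funeq[of \<sigma>] using nonneg[of "1 - \<sigma>"] d that by (intro add_nonneg_pos) auto
  note threshold = order_threshold_properties[OF f poly, where c = "1/2", folded \<mu>_def b_def]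
  have thr1: "b \<le> 1" by (rule threshold(1)) (fact left_pos zero)+
  have thr2: "\<mu> \<sigma> > 0" if "\<sigma> < b" for \<sigma> by (rule threshold(2)[OF _ _ that]) (fact left_pos zero)+
  have thr3: "\<mu> \<sigma> = 0" if "\<sigma> \<ge> b" for \<sigma> by (rule threshold(3)[OF _ _ that]) (fact left_pos zero)+
  have reflect: "(\<mu> has_real_derivative - D - d) (at \<sigma>)" if "(\<mu> has_real_derivative D) (at (1 - \<sigma>))" for D \<sigma>
  proof -
    have "((\<lambda>\<sigma>. \<mu> (1 - \<sigma>)) has_real_derivative D * (- 1)) (at \<sigma>)"
      using that by (rule DERIV_chain2[where g = "\<lambda>\<sigma>. 1 - \<sigma>"]) (auto intro!: derivative_eq_intros)
    then have "((\<lambda>\<sigma>. \<mu> (1 - \<sigma>) + d * (1/2 - \<sigma>)) has_real_derivative - D - d) (at \<sigma>)"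
      by (auto intro!: derivative_eq_intros)
    moreover have "(\<lambda>\<sigma>. \<mu> (1 - \<sigma>) + d * (1/2 - \<sigma>)) = \<mu>"
      by (intro ext funeq[symmetric])
    ultimately show ?thesis by (simp only:)
  qed
  have stationary: "D = 0" if "(\<mu> has_real_derivative D) (at \<sigma>)" "\<mu> \<sigma> = 0" for D \<sigma>
    by (rule DERIV_local_min[OF that(1) zero_less_one]) (use that nonneg in auto)
  obtain D where D: "(\<mu> has_real_derivative D) (at (1/2))"
    using assms(9) unfolding real_differentiable_def by blast
  \<comment> \<open>The reflection fixes 1/2, so the differentiated functional equation determines
    the slope there.\<close>
  have "D = - D - d" using reflect[of D "1/2"] D by (intro DERIV_unique[OF D]) simp
  then have Dd: "D = - d / 2" by simp
  have b: "1/2 < b"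
  proof (rule ccontr)
    assume "\<not> 1/2 < b"
    then have "D = 0" using thr3[of "1/2"] by (intro stationary[OF D]) simp
    with Dd d show False by simp
  qed
  have inv: "convex_on {..<b} (\<lambda>\<sigma>. 1 / \<mu> \<sigma>)"
    unfolding \<mu>_def
    by (rule convex_on_inverse_order_function[OF f poly assms(8) _ thr1]) (use zero thr2 in \<open>simp_all add: \<mu>_def\<close>)
  have diff_left: "\<mu> differentiable (at \<sigma>)" if "\<sigma> < b" for \<sigma>
    by (rule differentiable_of_convex_inverse[OF convex_on_subset[OF conv] inv])
       (use that thr2 in auto)
  have diff: "\<mu> differentiable (at \<sigma>)" for \<sigma>
  proof (cases "\<sigma> < b")
    case False
    \<comment> \<open>Here 1 - \<sigma> \<le> 1 - b < 1/2 < b; the case \<sigma> = b is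
      included.\<close>
    then have "1 - \<sigma> < b" using b by simp
    then obtain D' where "(\<mu> has_real_derivative D') (at (1 - \<sigma>))"
      using diff_left unfolding real_differentiable_def by blast
    from reflect[OF this] show ?thesis unfolding real_differentiable_def by blast
  qed (rule diff_left)
  obtain D\<^sub>1 where D1: "(\<mu> has_real_derivative D\<^sub>1) (at 1)"
    using diff unfolding real_differentiable_def by blast
  \<comment> \<open>The slope at 0 is read off at its mirror image 1, which is a minimum of
    \<mu>.\<close>
  have "D\<^sub>1 = 0" by (rule stationary[OF D1]) (simp add: zero)
  then have D0: "(\<mu> has_real_derivative - d) (at 0)" using reflect[of 0 0] D1 by simp
  have \<mu>0: "\<mu> 0 = d / 2" using funeq[of 0] zero[of 1] by simp
  have tangent: "2 / d + 4 / d * \<sigma> \<le> 1 / \<mu> \<sigma>" if "\<sigma> < b" for \<sigma>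
  proof -
    have "((\<lambda>\<sigma>. 1 / \<mu> \<sigma>) has_real_derivative 4 / d) (at 0)"
      using D0 d by (auto intro!: derivative_eq_intros simp: \<mu>0 field_simps)
    then have "((\<lambda>\<sigma>. 1 / \<mu> \<sigma>) has_real_derivative 4 / d) (at 0 within {..<b})"
      by (rule has_field_derivative_at_within)
    then have "4 / d * (\<sigma> - 0) \<le> 1 / \<mu> \<sigma> - 1 / \<mu> 0"
      using b that by (intro convex_on_imp_above_tangent[OF inv]) (auto simp: interior_open)
    then show ?thesis by (simp add: \<mu>0)
  qed
  have bound: "\<mu> \<sigma> \<le> d / (2 + 4 * \<sigma>)" if "0 \<le> \<sigma>" "\<sigma> < b" for \<sigma>
    using tangent[OF that(2)] thr2[OF that(2)] that(1) d by (simp add: field_simps)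
  have identity: "d / (2 + 4 * \<sigma>) = d * (1/2 - \<sigma>) + 2 * d * \<sigma>\<^sup>2 / (1 + 2 * \<sigma>)" if "0 \<le> \<sigma>" for \<sigma>
    using that by (simp add: field_simps power2_eq_square)
  have strict: "\<mu> (1/2) < d / 4"
  proof (rule ccontr)
    assume "\<not> \<mu> (1/2) < d / 4"
    with bound[of "1/2"] b have \<mu>h: "\<mu> (1/2) = d / 4" by simp
    let ?W = "\<lambda>\<sigma>. 1 / \<mu> \<sigma> - (2 / d + 4 / d * \<sigma>)"
    \<comment> \<open>In case of equality 1/\<mu> would have slope (d/2) / (d/4)^2 = 8/d at 1/2,
      against 4/d for the line that it touches from above.\<close>
    have "(?W has_real_derivative 4 / d) (at (1/2))"
      using D d by (auto intro!: derivative_eq_intros simp: \<mu>h Dd field_simps)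
    then have "4 / d = 0"
    proof (rule DERIV_local_min)
      \<comment> \<open>This radius keeps y below b, where the tangent bound holds.\<close>
      show "0 < b - 1/2" using b by simp
      show "\<forall>y. \<bar>1/2 - y\<bar> < b - 1/2 \<longrightarrow> ?W (1/2) \<le> ?W y"
      proof (intro allI impI)
        fix y assume "\<bar>1/2 - y\<bar> < b - 1/2"
        then have "y < b" by linarith
        with tangent[of y] show "?W (1/2) \<le> ?W y" using d by (simp add: \<mu>h field_simps)
      qed
    qed
    then show False using d by simp
  qed
  have right: "\<mu> \<sigma> \<le> 2 * d * (1 - \<sigma>)\<^sup>2" if \<sigma>: "1 - b < \<sigma>" "\<sigma> \<le> 1" for \<sigma>
  proof -
    have "\<mu> (1 - \<sigma>) \<le> d * (1/2 - (1 - \<sigma>)) + 2 * d * (1 - \<sigma>)\<^sup>2 / (1 + 2 * (1 - \<sigma>))"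
      using bound[of "1 - \<sigma>"] identity[of "1 - \<sigma>"] \<sigma> by simp
    \<comment> \<open>The linear term of the bound at 1 - \<sigma> cancels the one in the functional
      equation, leaving only the quadratic remainder.\<close>
    then have "\<mu> \<sigma> \<le> 2 * d * (1 - \<sigma>)\<^sup>2 / (1 + 2 * (1 - \<sigma>))"
      unfolding funeq[of \<sigma>] by (simp add: algebra_simps)
    also have "\<dots> \<le> 2 * d * (1 - \<sigma>)\<^sup>2 / 1"
      using \<sigma> d by (intro divide_left_mono) auto
    finally show ?thesis by simp
  qed
  show ?thesis using diff strict bound identity right by blast
qed

end
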